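(* Any $\boldsymbol x^*\in\mathcal S$ is a variational equilibrium of the exact potential game $\Gamma=(\mathcal I,\{J_i\}_{i\in\mathcal I},\{\mathcal X_i\}_{i\in\mathcal I})$; that is, if $\boldsymbol x^*=(q^*;\dot q^* )\in\boldsymbol{\mathcal X}$ satisfies $(\bar Bq^*;\dot q^* )\in\mathcal S$, then $$(\boldsymbol y-\boldsymbol x^* )^\top\mathbf F(\boldsymbol x^* )\ge0\qquad\text{for all }\boldsymbol y\in\boldsymbol{\mathcal X}.$$
   Context: Notation: $(x_1;\ldots;x_N)$ denotes the stacked column vector, $\|\cdot\|$ is the Euclidean norm, and $\otimes$ is the Kronecker product. Agents and graph: there are $N$ agents, indexed by $\mathcal I=\{1,\ldots,N\}$, with positions $q_i\in\mathbb R^n$, velocities $\dot q_i\in\mathbb R^n$ and momenta $p_i=\dot q_i$; $q=(q_1;\ldots;q_N)$, $p=\dot q$. $\mathcal G=(V,E)$ is a graph with $V=\mathcal I$ and $|E|=M$ arbitrarily oriented edges. $B=(b_{i,j})\in\mathbb R^{N\times M}$ is the incidence matrix ($b_{i,j}=-1$ if $i$ is the tail of edge $j$, $+1$ if it is the head, $0$ otherwise). Put $\bar B:=B^\top\otimes I_n$ and $z=\bar Bq$. To each edge $j\in E$ are associated a constant elastic coefficient $k_j>0$ and a rest length $r_j$ with $0\le r_j\le r^{\mathrm c}$, where $r^{\mathrm c}>0$ is a critical distance. The Hamiltonian is $H(z,p)=\frac12\sum_{i\in\mathcal I}p_i^\top p_i+\frac12\sum_{j\in E}k_j(\|z_j\|-r_j)^2$.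 Sets: $\mathcal Z:=\{\bar z\in\mathbb R^{nM}\;|\;\frac{\partial H}{\partial z}|_{z=\bar z}\in\ker(\bar B^\top)\}$ and $\mathcal S:=\{(z;p)\in\mathbb R^{n(M+N)}\;|\;z\in\mathcal Z,\ p=0\}$. Game: player $i$ has decision variable $x_i=(q_i;\dot q_i)\in\mathcal X_i\subset\mathbb R^{2n}$, with $\mathcal X_i$ compact and convex; $\boldsymbol x=(q;\dot q)\in\boldsymbol{\mathcal X}=\prod_{i\in\mathcal I}\mathcal X_i$ (up to ordering of coordinates). With $\mathcal L_i:=\{j\in E\;|\;b_{i,j}\neq0\}$, the objective of player $i$ is $$J_i(x_i,\boldsymbol x_{-i})=\frac12\Big(\dot q_i^\top\dot q_i+\sum_{\ell\in\mathcal L_i}k_\ell(\|q_i-q_k\|-r_\ell)^2\Big),$$ where in the $\ell$-th summand $k$ in $q_k$ denotes the other endpoint of edge $\ell$. The pseudo-gradient is $\mathbf F(\boldsymbol x)=(\nabla_{x_i}J_i(\boldsymbol x))_{i\in\mathcal I}$ (stacked with the same coordinate ordering as $\boldsymbol x$). A variational equilibrium is a point $\boldsymbol x^*\in\boldsymbol{\mathcal X}$ satisfying the variational inequality $(\boldsymbol y-\boldsymbol x^* )^\top\mathbf F(\boldsymbol x^* )\ge0$ for all $\boldsymbol y\in\boldsymbol{\mathcal X}$. *)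

theory Defs
  imports "HOL-Analysis.Analysis"
begin

(* Agents are the elements of a finite type 'v and R^n is real^'n.  The stacked space R^{nN}
   is real^('v * 'n), with block structure given by the first index component. *)

definition block :: "real ^ ('a::finite \<times> 'n::finite) \<Rightarrow> 'a \<Rightarrow> real ^ 'n" where
  "block w i = (\<chi> a. w $ (i, a))"

definition kronecker ::
    "real ^ 'b ^ 'a \<Rightarrow> real ^ 'd ^ 'c \<Rightarrow> real ^ ('b::finite \<times> 'd::finite) ^ ('a::finite \<times> 'c::finite)" where
  "kronecker A C = (\<chi> r s. A $ fst r $ fst s * C $ snd r $ snd s)"

(* The edges form a subset E of a finite label type 'e, so that edgeless graphs are covered as
   well (HOL types are nonempty).  Parallel edges are not excluded. *)

definition oriented_graph :: "'e set \<Rightarrow> ('e \<Rightarrow> 'v) \<Rightarrow> ('e \<Rightarrow> 'v) \<Rightarrow> bool" where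
  "oriented_graph E tail head \<longleftrightarrow> (\<forall>j\<in>E. tail j \<noteq> head j)"

definition incidence :: "'e set \<Rightarrow> ('e \<Rightarrow> 'v) \<Rightarrow> ('e \<Rightarrow> 'v) \<Rightarrow> real ^ 'e::finite ^ 'v::finite" where
  "incidence E tail head =
     (\<chi> i j. if j \<in> E \<and> i = tail j then - 1 else if j \<in> E \<and> i = head j then 1 else 0)"

definition Bbar ::
    "'e set \<Rightarrow> ('e \<Rightarrow> 'v) \<Rightarrow> ('e \<Rightarrow> 'v) \<Rightarrow> real ^ ('v::finite \<times> 'n::finite) ^ ('e::finite \<times> 'n)" where
  "Bbar E tail head = kronecker (transpose (incidence E tail head)) (mat 1)"

(* R^{nM} with M = card E, realised as the coordinate subspace of vectors vanishing off E. *)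

definition edge_space :: "'e set \<Rightarrow> (real ^ ('e::finite \<times> 'n::finite)) set" where
  "edge_space E = {z. \<forall>j. j \<notin> E \<longrightarrow> block z j = 0}"

definition Hamiltonian ::
    "'e set \<Rightarrow> ('e \<Rightarrow> real) \<Rightarrow> ('e \<Rightarrow> real) \<Rightarrow>
     real ^ ('e::finite \<times> 'n::finite) \<Rightarrow> real ^ ('v::finite \<times> 'n) \<Rightarrow> real" where
  "Hamiltonian E k r z p =
     1/2 * (\<Sum>i\<in>UNIV. block p i \<bullet> block p i) +
     1/2 * (\<Sum>j\<in>E. k j * (norm (block z j) - r j)\<^sup>2)"

(* The Hamiltonian is not differentiable at z if some z_j = 0 with r_j > 0; membership in
   Z_set requires the gradient to exist.  The gradient does not depend on p. *)

definition Z_set ::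
    "'e set \<Rightarrow> ('e \<Rightarrow> 'v::finite) \<Rightarrow> ('e \<Rightarrow> 'v) \<Rightarrow> ('e \<Rightarrow> real) \<Rightarrow> ('e \<Rightarrow> real) \<Rightarrow>
     (real ^ ('e::finite \<times> 'n::finite)) set" where
  "Z_set E tail head k r =
     {z \<in> edge_space E.
        \<exists>g. (\<forall>p :: real ^ ('v \<times> 'n). GDERIV (\<lambda>w. Hamiltonian E k r w p) z :> g) \<and>
            transpose (Bbar E tail head :: real ^ ('v \<times> 'n) ^ ('e \<times> 'n)) *v g = 0}"

definition S_set ::
    "'e set \<Rightarrow> ('e \<Rightarrow> 'v) \<Rightarrow> ('e \<Rightarrow> 'v) \<Rightarrow> ('e \<Rightarrow> real) \<Rightarrow> ('e \<Rightarrow> real) \<Rightarrow>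
     ((real ^ ('e::finite \<times> 'n::finite)) \<times> (real ^ ('v::finite \<times> 'n))) set" where
  "S_set E tail head k r = {(z, p). z \<in> Z_set E tail head k r \<and> p = 0}"

(* Games: a joint strategy is a vector x :: 's^'v whose component x $ i is the decision of
   player i; J i x is the cost of player i and the strategy sets X i are decoupled. *)

definition joint_strategies :: "('v \<Rightarrow> 's set) \<Rightarrow> ('s ^ 'v::finite) set" where
  "joint_strategies X = {x. \<forall>i. x $ i \<in> X i}"

definition deviate :: "'s ^ 'v::finite \<Rightarrow> 'v \<Rightarrow> 's \<Rightarrow> 's ^ 'v" where
  "deviate x i \<xi> = (\<chi> l. if l = i then \<xi> else x $ l)"

definition exact_potential_game ::
    "('v::finite \<Rightarrow> 's ^ 'v \<Rightarrow> real) \<Rightarrow> ('v \<Rightarrow> 's set) \<Rightarrow> bool" where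
  "exact_potential_game J X \<longleftrightarrow>
     (\<exists>P :: 's ^ 'v \<Rightarrow> real. \<forall>i. \<forall>x \<in> joint_strategies X. \<forall>\<xi> \<in> X i.
        J i (deviate x i \<xi>) - J i x = P (deviate x i \<xi>) - P x)"

definition has_pseudo_gradient ::
    "('v::finite \<Rightarrow> 's ^ 'v \<Rightarrow> real) \<Rightarrow> 's::real_inner ^ 'v \<Rightarrow> 's ^ 'v \<Rightarrow> bool" where
  "has_pseudo_gradient J x F \<longleftrightarrow> (\<forall>i. GDERIV (\<lambda>\<xi>. J i (deviate x i \<xi>)) (x $ i) :> F $ i)"

(* The vector F below is unique if it exists, since gradients are. *)

definition variational_equilibrium ::
    "('v::finite \<Rightarrow> 's ^ 'v \<Rightarrow> real) \<Rightarrow> ('v \<Rightarrow> 's set) \<Rightarrow> 's::real_inner ^ 'v \<Rightarrow> bool" where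
  "variational_equilibrium J X x \<longleftrightarrow>
     x \<in> joint_strategies X \<and>
     (\<exists>F. has_pseudo_gradient J x F \<and> (\<forall>y \<in> joint_strategies X. (y - x) \<bullet> F \<ge> 0))"

definition join ::
    "real ^ ('v::finite \<times> 'n::finite) \<Rightarrow> real ^ ('v \<times> 'n) \<Rightarrow> ((real ^ 'n) \<times> (real ^ 'n)) ^ 'v" where
  "join q v = (\<chi> i. (block q i, block v i))"

definition incident_edges :: "'e set \<Rightarrow> ('e::finite \<Rightarrow> 'v::finite) \<Rightarrow> ('e \<Rightarrow> 'v) \<Rightarrow> 'v \<Rightarrow> 'e set" where
  "incident_edges E tail head i = {j \<in> E. incidence E tail head $ i $ j \<noteq> 0}"

definition other_end :: "('e \<Rightarrow> 'v) \<Rightarrow> ('e \<Rightarrow> 'v) \<Rightarrow> 'v \<Rightarrow> 'e \<Rightarrow> 'v" where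
  "other_end tail head i j = (if tail j = i then head j else tail j)"

definition cost ::
    "'e set \<Rightarrow> ('e::finite \<Rightarrow> 'v::finite) \<Rightarrow> ('e \<Rightarrow> 'v) \<Rightarrow> ('e \<Rightarrow> real) \<Rightarrow> ('e \<Rightarrow> real) \<Rightarrow>
     'v \<Rightarrow> ((real ^ 'n::finite) \<times> (real ^ 'n)) ^ 'v \<Rightarrow> real" where
  "cost E tail head k r i x =
     1/2 * (snd (x $ i) \<bullet> snd (x $ i) +
            (\<Sum>l\<in>incident_edges E tail head i.
               k l * (norm (fst (x $ i) - fst (x $ other_end tail head i l)) - r l)\<^sup>2))"

end

(* The Hamiltonian, read as a function of the joint strategy through z = Bbar q, is an exact
   potential: without self-loops, the terms not appearing in J_i do not involve the strategy of
   player i. Hence the pseudo-gradient at a point is the gradient of the potential, whose position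
   part is Bbar^T (dH/dz) and whose velocity part is the velocity itself. On S both vanish, so F = 0
   and the variational inequality is trivial. By the chain rule the gradient of the elastic
   energy never has to be computed. *)

theory Submission imports Defs begin

text \<open>Inverse to taking blocks. A joint strategy is indexed by players, while
  \<open>Bbar\<close> acts on flattened vectors; this is the passage from the former to the
  latter.\<close>

definition stack :: "(real ^ 'n) ^ 'v \<Rightarrow> real ^ ('v::finite \<times> 'n::finite)" where
  "stack w = (\<chi> s. w $ fst s $ snd s)"

lemma block_stack [simp]: "block (stack w) i = w $ i"
  by (simp add: block_def stack_def vec_eq_iff)

lemma stack_axis_0 [simp]: "stack (axis i 0) = 0"
  by (simp add: stack_def axis_def vec_eq_iff)

lemma stack_add: "stack (u + w) = stack u + stack w"
  by (simp add: stack_def vec_eq_iff)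

lemma stack_scaleR: "stack (c *\<^sub>R w) = c *\<^sub>R stack w"
  by (simp add: stack_def vec_eq_iff)

text \<open>The identity factor annihilates all terms with a different inner coordinate, so A
  \<otimes> I acts on blocks as A acts on scalars.\<close>

lemma block_kronecker_mat_1:
  "block (kronecker A (mat 1) *v u) j = (\<Sum>i\<in>UNIV. A $ j $ i *\<^sub>R block u i)"
proof -
  have "(\<Sum>s\<in>UNIV. A $ j $ fst s * mat 1 $ a $ snd s * u $ s) = (\<Sum>i\<in>UNIV. A $ j $ i * u $ (i, a))"
    for a
  proof -
    have "(\<Sum>s\<in>UNIV. A $ j $ fst s * mat 1 $ a $ snd s * u $ s)
        = (\<Sum>i\<in>UNIV. \<Sum>b\<in>UNIV. A $ j $ i * mat 1 $ a $ b * u $ (i, b))"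
      by (simp add: sum.cartesian_product UNIV_Times_UNIV case_prod_unfold)
    also have "\<dots> = (\<Sum>i\<in>UNIV. A $ j $ i * u $ (i, a))"
    proof (rule sum.cong [OF refl])
      fix i
      have "(\<Sum>b\<in>UNIV. A $ j $ i * mat 1 $ a $ b * u $ (i, b))
          = (\<Sum>b\<in>UNIV. if b = a then A $ j $ i * u $ (i, b) else 0)"
        by (rule sum.cong) (auto simp: mat_def)
      then show "(\<Sum>b\<in>UNIV. A $ j $ i * mat 1 $ a $ b * u $ (i, b)) = A $ j $ i * u $ (i, a)"
        by simp
    qed
    finally show ?thesis .
  qed
  then show ?thesis
    by (simp add: vec_eq_iff block_def kronecker_def matrix_vector_mult_def)
qed

lemma block_Bbar:
  assumes "oriented_graph E tail head" "j \<in> E"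
  shows "block (Bbar E tail head *v u) j = block u (head j) - block u (tail j)"
proof -
  have ne: "tail j \<noteq> head j"
    using assms by (simp add: oriented_graph_def)
  have "block (Bbar E tail head *v u) j
      = (\<Sum>i\<in>UNIV. incidence E tail head $ i $ j *\<^sub>R block u i)"
    by (simp add: Bbar_def block_kronecker_mat_1 transpose_def)
  \<comment> \<open>The nested conditional of \<open>incidence\<close> is a difference of two
    indicators only because \<open>tail j\<close> and \<open>head j\<close> differ; at a self-loop
    it would give -1 instead of 0.\<close>
  also have "\<dots> = (\<Sum>i\<in>UNIV. (if i = head j then block u i else 0) - (if i = tail j then block u i else 0))"
    using assms(2) ne by (intro sum.cong) (auto simp: incidence_def)
  also have "\<dots> = block u (head j) - block u (tail j)"
    by (simp add: sum_subtractf)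
  finally show ?thesis .
qed

text \<open>Kept as a composition with \<open>Bbar\<close>, so that the gradient provided by
  \<open>Z_set\<close> can enter through the chain rule.\<close>

definition potential ::
    "'e set \<Rightarrow> ('e::finite \<Rightarrow> 'v::finite) \<Rightarrow> ('e \<Rightarrow> 'v) \<Rightarrow> ('e \<Rightarrow> real) \<Rightarrow> ('e \<Rightarrow> real) \<Rightarrow>
     ((real ^ 'n::finite) \<times> (real ^ 'n)) ^ 'v \<Rightarrow> real" where
  "potential E tail head k r x =
     Hamiltonian E k r (Bbar E tail head *v stack (\<chi> i. fst (x $ i))) (stack (\<chi> i. snd (x $ i)))"

lemma potential_eq:
  assumes "oriented_graph E tail head"
  shows "potential E tail head k r x =
     1/2 * (\<Sum>i\<in>UNIV. snd (x $ i) \<bullet> snd (x $ i)) +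
     1/2 * (\<Sum>j\<in>E. k j * (norm (fst (x $ head j) - fst (x $ tail j)) - r j)\<^sup>2)"
  by (simp add: potential_def Hamiltonian_def block_Bbar [OF assms])

lemma incident_edges_eq: "incident_edges E tail head i = {j \<in> E. tail j = i \<or> head j = i}"
  by (auto simp: incident_edges_def incidence_def)

text \<open>The bracketed remainder collects the other players' kinetic terms and the edges with
  neither end at i, so no deviation of player i changes it.\<close>

lemma potential_eq_cost_plus:
  assumes "oriented_graph E tail head"
  shows "potential E tail head k r x = cost E tail head k r i x +
     (1/2 * (\<Sum>l\<in>- {i}. snd (x $ l) \<bullet> snd (x $ l)) +
      1/2 * (\<Sum>j | j \<in> E \<and> tail j \<noteq> i \<and> head j \<noteq> i.
        k j * (norm (fst (x $ head j) - fst (x $ tail j)) - r j)\<^sup>2))"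
proof -
  define e where "e j = k j * (norm (fst (x $ head j) - fst (x $ tail j)) - r j)\<^sup>2" for j
  let ?I = "incident_edges E tail head i"
  have "(\<Sum>l\<in>UNIV. snd (x $ l) \<bullet> snd (x $ l))
      = snd (x $ i) \<bullet> snd (x $ i) + (\<Sum>l\<in>- {i}. snd (x $ l) \<bullet> snd (x $ l))"
    by (simp add: sum.remove [of UNIV i] Compl_eq_Diff_UNIV)
  moreover have "sum e E = sum e ?I + sum e {j. j \<in> E \<and> tail j \<noteq> i \<and> head j \<noteq> i}"
    by (subst sum.union_disjoint [symmetric]) (auto simp: incident_edges_eq intro: sum.cong)
  \<comment> \<open>If i is the tail of an edge, the two differences have opposite signs, which the
    norm does not see.\<close>
  moreover have "sum e ?I = (\<Sum>l\<in>?I.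
      k l * (norm (fst (x $ i) - fst (x $ other_end tail head i l)) - r l)\<^sup>2)"
    by (rule sum.cong) (auto simp: e_def incident_edges_eq other_end_def norm_minus_commute)
  ultimately show ?thesis
    unfolding potential_eq [OF assms] cost_def e_def [symmetric] by (simp add: algebra_simps)
qed

lemma deviate_nth [simp]: "deviate x i \<xi> $ l = (if l = i then \<xi> else x $ l)"
  by (simp add: deviate_def)

lemma cost_deviate:
  assumes "oriented_graph E tail head"
  shows "cost E tail head k r i (deviate x i \<xi>) - cost E tail head k r i x =
     potential E tail head k r (deviate x i \<xi>) - potential E tail head k r x"
  by (simp add: potential_eq_cost_plus [OF assms, where i = i])

lemma exact_potential_game_cost:
  assumes "oriented_graph E tail head"
  shows "exact_potential_game (cost E tail head k r) X"
  unfolding exact_potential_game_def using cost_deviate [OF assms] by blast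

text \<open>Prepares the chain rule: a deviation shifts q by a vector supported on block i, and with
  all other players at rest the kinetic energy is that of player i alone.\<close>

lemma potential_deviate_join_0:
  fixes q :: "real ^ ('v::finite \<times> 'n::finite)"
  assumes "oriented_graph E tail head"
  shows "potential E tail head k r (deviate (join q 0) i \<xi>) =
     Hamiltonian E k r (Bbar E tail head *v (q + stack (axis i (fst \<xi> - block q i))))
       (0 :: real ^ ('v \<times> 'n)) + 1/2 * (snd \<xi> \<bullet> snd \<xi>)"
proof -
  have "stack (\<chi> l. fst (deviate (join q 0) i \<xi> $ l)) = q + stack (axis i (fst \<xi> - block q i))"
    by (auto simp: vec_eq_iff stack_def join_def block_def axis_def)
  moreover have "(\<Sum>l\<in>UNIV. snd (deviate (join q 0) i \<xi> $ l) \<bullet> snd (deviate (join q 0) i \<xi> $ l))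
      = (\<Sum>l\<in>UNIV. if l = i then snd \<xi> \<bullet> snd \<xi> else 0)"
    by (rule sum.cong) (auto simp: join_def block_def vec_eq_iff inner_vec_def)
  ultimately show ?thesis
    by (simp add: potential_def Hamiltonian_def block_def[of 0] zero_vec_def[symmetric])
qed

text \<open>The position part of the derivative pairs a direction supported on block i with Bbar^T g
  = 0; the kinetic part is a quadratic form at its minimum.\<close>

lemma GDERIV_potential_deviate:
  fixes q :: "real ^ ('v::finite \<times> 'n::finite)"
    and E :: "'e::finite set"
  assumes "oriented_graph E tail head"
    and crit: "Bbar E tail head *v q \<in> Z_set E tail head k r"
  shows "GDERIV (\<lambda>\<xi>. potential E tail head k r (deviate (join q 0) i \<xi>)) (join q 0 $ i) :> 0"
proof -
  let ?B = "Bbar E tail head :: real ^ ('v \<times> 'n) ^ ('e \<times> 'n)"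
  let ?H = "\<lambda>w. Hamiltonian E k r w (0 :: real ^ ('v \<times> 'n))"
  let ?x = "join q 0 $ i"
  let ?L = "\<lambda>h :: (real ^ 'n) \<times> (real ^ 'n). ?B *v stack (axis i (fst h))"
  let ?u = "\<lambda>\<xi> :: (real ^ 'n) \<times> (real ^ 'n). ?B *v (q + stack (axis i (fst \<xi> - block q i)))"
  \<comment> \<open>Membership in \<open>Z_set\<close> includes differentiability at
    \<open>Bbar q\<close>, so the kink of the norm at 0 calls for no case distinction.\<close>
  obtain g where g: "GDERIV ?H (?B *v q) :> g" and g0: "transpose ?B *v g = 0"
    using crit unfolding Z_set_def by blast
  have x: "?x = (block q i, 0)"
    by (simp add: join_def block_def vec_eq_iff)
  have "linear ?L"
  proof
    fix a b :: "(real ^ 'n) \<times> (real ^ 'n)" and c :: real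
    have "axis i (fst (a + b)) = axis i (fst a) + axis i (fst b)"
      by (simp add: axis_def vec_eq_iff)
    then show "?L (a + b) = ?L a + ?L b"
      by (simp add: stack_add matrix_vector_right_distrib)
    have "axis i (fst (c *\<^sub>R a)) = c *\<^sub>R axis i (fst a)"
      by (simp add: axis_def vec_eq_iff)
    then show "?L (c *\<^sub>R a) = c *\<^sub>R ?L a"
      by (simp add: stack_scaleR matrix_vector_mult_scaleR)
  qed
  then have L: "bounded_linear ?L"
    by (simp add: linear_conv_bounded_linear)
  \<comment> \<open>Written as an affine map centred at \<open>?x\<close>, \<open>?u\<close> visibly
    has the linear part \<open>?L\<close> as its derivative.\<close>
  have u_eq: "?u = (\<lambda>\<xi>. ?B *v q + ?L (\<xi> - ?x))"
    by (simp add: matrix_vector_right_distrib x)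
  have "((\<lambda>\<xi>. ?B *v q + ?L (\<xi> - ?x)) has_derivative (\<lambda>h. 0 + ?L (h - 0))) (at ?x)"
    by (intro has_derivative_add has_derivative_const bounded_linear.has_derivative [OF L]
        has_derivative_diff has_derivative_ident)
  then have "(?u has_derivative ?L) (at ?x)"
    unfolding u_eq by simp
  moreover have "?u ?x = ?B *v q"
    by (simp add: x)
  ultimately have "((\<lambda>\<xi>. ?H (?u \<xi>)) has_derivative (\<lambda>h. ?L h \<bullet> g)) (at ?x)"
    using g has_derivative_compose [of ?u ?L ?x UNIV ?H "\<lambda>h. h \<bullet> g"]
    by (simp add: gderiv_def)
  \<comment> \<open>Moving \<open>?B\<close> across the inner product turns it into its transpose
    applied to g.\<close>
  moreover have "?L h \<bullet> g = 0" for h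
    using g0 by (simp add: inner_commute [of _ g] dot_lmul_matrix [symmetric])
  ultimately have "((\<lambda>\<xi>. ?H (?u \<xi>)) has_derivative (\<lambda>h. 0)) (at ?x)"
    by simp
  moreover have "((\<lambda>\<xi>. 1/2 * (snd \<xi> \<bullet> snd \<xi>)) has_derivative (\<lambda>h. 0)) (at ?x)"
    by (auto intro!: derivative_eq_intros simp: x)
  ultimately have "((\<lambda>\<xi>. ?H (?u \<xi>) + 1/2 * (snd \<xi> \<bullet> snd \<xi>)) has_derivative (\<lambda>h. 0 + 0)) (at ?x)"
    by (rule has_derivative_add)
  then show ?thesis
    by (simp add: potential_deviate_join_0 [OF assms(1)] gderiv_def)
qed

text \<open>Along deviations of player i the cost differs from the potential by a constant, hence
  has the same gradient.\<close>

lemma has_pseudo_gradient_cost_0: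
  assumes "oriented_graph E tail head"
    and "Bbar E tail head *v q \<in> Z_set E tail head k r"
  shows "has_pseudo_gradient (cost E tail head k r) (join q 0) 0"
proof -
  let ?x = "join q 0"
  have "GDERIV (\<lambda>\<xi>. cost E tail head k r i (deviate ?x i \<xi>)) (?x $ i) :> 0" for i
  proof -
    have "(\<lambda>\<xi>. cost E tail head k r i (deviate ?x i \<xi>)) = (\<lambda>\<xi>.
        potential E tail head k r (deviate ?x i \<xi>) +
        (cost E tail head k r i ?x - potential E tail head k r ?x))"
      using cost_deviate [OF assms(1), of k r i ?x] by (auto simp: fun_eq_iff algebra_simps)
    then show ?thesis
      using GDERIV_add [OF GDERIV_potential_deviate [OF assms] GDERIV_const] by simp
  qed
  then show ?thesis
    by (simp add: has_pseudo_gradient_def)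
qed

theorem proposition3:
  fixes E :: "'e::finite set"
    and tail head :: "'e \<Rightarrow> 'v::finite"
    and k r :: "'e \<Rightarrow> real"
    and rc :: real
    and X :: "'v \<Rightarrow> ((real ^ 'n::finite) \<times> (real ^ 'n)) set"
    and q v :: "real ^ ('v \<times> 'n)"
  assumes "oriented_graph E tail head"
    and "\<And>j. j \<in> E \<Longrightarrow> k j > 0"
    and "rc > 0"
    and "\<And>j. j \<in> E \<Longrightarrow> 0 \<le> r j \<and> r j \<le> rc"
    and "\<And>i. compact (X i)"
    and "\<And>i. convex (X i)"
    and "join q v \<in> joint_strategies X"
    and "(Bbar E tail head *v q, v) \<in> S_set E tail head k r"
  shows "exact_potential_game (cost E tail head k r) X \<and>
         variational_equilibrium (cost E tail head k r) X (join q v)"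
proof
  show "exact_potential_game (cost E tail head k r) X"
    by (rule exact_potential_game_cost [OF assms(1)])
  have "v = 0" and "Bbar E tail head *v q \<in> Z_set E tail head k r"
    using assms(8) by (auto simp: S_set_def)
  then have "has_pseudo_gradient (cost E tail head k r) (join q v) 0"
    using has_pseudo_gradient_cost_0 [OF assms(1)] by simp
  then show "variational_equilibrium (cost E tail head k r) X (join q v)"
    unfolding variational_equilibrium_def using assms(7) by (intro conjI exI [of _ 0]) simp_all
qed

end
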